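(* Let $d\ge 3$ and let $\mu=(\mu_1,\dots,\mu_d)$ and $\nu=(\nu_1,\dots,\nu_d)$ be two points of $\mathbb{R}^d/\mathbb{R}{\bf 1}$ in general position, i.e. $\mu_i-\nu_i\ne\mu_j-\nu_j$ for all $1\le i<j\le d$. Then there is a unique Stiefel tropical linear space of dimension one, with Plücker coordinates $P_{ij}$ ($1\le i<j\le d$), that passes through both $\mu$ and $\nu$, and its Plücker coordinates are obtained (up to a common additive constant) as the tropical determinants $$P_{ij}=\mathrm{tdet}\begin{pmatrix}\mu_i&\mu_j\\\nu_i&\nu_j\end{pmatrix}=\max(\mu_i+\nu_j,\ \mu_j+\nu_i).$$
   Context: ${\bf 1}=(1,\dots,1)$. For a $2\times d$ matrix $A$ over $\mathbb{R}\cup\{-\infty\}$, its Plücker coordinates are $P_{ij}=P_{ji}=\max(A_{1i}+A_{2j},A_{1j}+A_{2i})$ for $i\neq j$ (the tropical determinants of its $2\times2$ minors), assumed not all equal to $-\infty$. The one-dimensional Stiefel tropical linear space of $A$ is the set of $x\in(\mathbb{R}\cup\{-\infty\})^d/\mathbb{R}{\bf 1}$ such that for every triple of distinct indices $i,j,k$ the maximum of $P_{jk}+x_i,\ P_{ik}+x_j,\ P_{ij}+x_k$ is attained at least twice. Adding a common constant to all $P_{ij}$ does not change the space. "Passes through" means contains. *)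

theory Defs
  imports "HOL-Analysis.Analysis"
begin

text \<open>
  The tropical numbers, i.e. the reals together with \<open>-\<infinity>\<close>, are the elements of type \<^typ>\<open>ereal\<close>
  other than \<open>\<infinity>\<close>; \<open>d\<close>-tuples and \<open>2 \<times> d\<close> matrices are vectors over a finite index type \<open>'d\<close>
  with \<open>d = CARD('d)\<close>.
\<close>

definition tropical_vec :: "ereal ^ 'd \<Rightarrow> bool" where
  "tropical_vec x \<longleftrightarrow> (\<forall>i. x $ i \<noteq> \<infinity>)"

text \<open>
  Translation by real multiples of the all-ones vector.  The quotient is taken on all of the tropical
  vectors, so the class of the constant vector \<open>-\<infinity>\<close> counts as a point.
\<close>

definition trop_equiv :: "((ereal ^ 'd) \<times> (ereal ^ 'd)) set" where
  "trop_equiv = {(x, y). tropical_vec x \<and> tropical_vec y \<and> (\<exists>c::real. \<forall>i. y $ i = ereal c + x $ i)}"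

definition trop_points :: "(ereal ^ 'd) set set" where
  "trop_points = Collect tropical_vec // trop_equiv"

definition real_point :: "real ^ 'd \<Rightarrow> (ereal ^ 'd) set" where
  "real_point \<mu> = trop_equiv `` {\<chi> i. ereal (\<mu> $ i)}"

text \<open>The tropical determinant of the matrix with rows \<open>(a, b)\<close> and \<open>(c, e)\<close>.\<close>

definition tdet2 :: "'a::{plus, ord} \<Rightarrow> 'a \<Rightarrow> 'a \<Rightarrow> 'a \<Rightarrow> 'a" where
  "tdet2 a b c e = max (a + e) (b + c)"

text \<open>Only the values at \<open>i \<noteq> j\<close> are meaningful.\<close>

definition plucker :: "ereal ^ 'd ^ 2 \<Rightarrow> 'd \<Rightarrow> 'd \<Rightarrow> ereal" where
  "plucker A i j = tdet2 (A $ 1 $ i) (A $ 1 $ j) (A $ 2 $ i) (A $ 2 $ j)"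

definition stiefel_matrix :: "ereal ^ 'd ^ 2 \<Rightarrow> bool" where
  "stiefel_matrix A \<longleftrightarrow>
     (\<forall>r. tropical_vec (A $ r)) \<and> (\<exists>i j. i \<noteq> j \<and> plucker A i j \<noteq> -\<infinity>)"

definition max_attained_twice :: "'a::linorder \<Rightarrow> 'a \<Rightarrow> 'a \<Rightarrow> bool" where
  "max_attained_twice a b c \<longleftrightarrow>
     (let m = Max {a, b, c} in (a = m \<and> b = m) \<or> (a = m \<and> c = m) \<or> (b = m \<and> c = m))"

definition satisfies_relations :: "('d \<Rightarrow> 'd \<Rightarrow> ereal) \<Rightarrow> ereal ^ 'd \<Rightarrow> bool" where
  "satisfies_relations P x \<longleftrightarrow>
     (\<forall>i j k. distinct [i, j, k] \<longrightarrow>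
        max_attained_twice (P j k + x $ i) (P i k + x $ j) (P i j + x $ k))"

definition stiefel_line :: "ereal ^ 'd ^ 2 \<Rightarrow> (ereal ^ 'd) set set" where
  "stiefel_line A = {p \<in> trop_points. \<forall>x\<in>p. satisfies_relations (plucker A) x}"

definition is_stiefel_line :: "(ereal ^ 'd) set set \<Rightarrow> bool" where
  "is_stiefel_line L \<longleftrightarrow> (\<exists>A. stiefel_matrix A \<and> L = stiefel_line A)"

lemma equiv_trop_equiv: "equiv (Collect tropical_vec) trop_equiv"
proof (rule equivI)
  show "trop_equiv \<subseteq> Collect tropical_vec \<times> (Collect tropical_vec :: (ereal ^ 'd) set)"
    by (auto simp: trop_equiv_def)
  show "refl_on (Collect tropical_vec) (trop_equiv :: ((ereal ^ 'd) \<times> (ereal ^ 'd)) set)"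
    by (auto simp: refl_on_def trop_equiv_def intro!: exI[of _ "0::real"])
  show "sym (trop_equiv :: ((ereal ^ 'd) \<times> (ereal ^ 'd)) set)"
  proof (rule symI)
    fix x y :: "ereal ^ 'd" assume "(x, y) \<in> trop_equiv"
    then obtain c where xy: "tropical_vec x" "tropical_vec y" "\<forall>i. y $ i = ereal c + x $ i"
      by (auto simp: trop_equiv_def)
    have "x $ i = ereal (- c) + y $ i" for i
      using xy(3) by (cases "x $ i") auto
    then show "(y, x) \<in> trop_equiv"
      using xy unfolding trop_equiv_def by blast
  qed
  show "trans (trop_equiv :: ((ereal ^ 'd) \<times> (ereal ^ 'd)) set)"
  proof (rule transI)
    fix x y z :: "ereal ^ 'd" assume "(x, y) \<in> trop_equiv" "(y, z) \<in> trop_equiv"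
    then obtain c c' where xyz: "tropical_vec x" "tropical_vec z"
        "\<forall>i. y $ i = ereal c + x $ i" "\<forall>i. z $ i = ereal c' + y $ i"
      unfolding trop_equiv_def by blast
    have "z $ i = ereal (c' + c) + x $ i" for i
      using xyz(3,4) by (cases "x $ i") auto
    then show "(x, z) \<in> trop_equiv"
      using xyz unfolding trop_equiv_def by blast
  qed
qed

lemma max_attained_twice_alt:
  "max_attained_twice a b c \<longleftrightarrow> (a = b \<and> c \<le> a) \<or> (a = c \<and> b \<le> a) \<or> (b = c \<and> a \<le> b)"
  by (auto simp: max_attained_twice_def Let_def max_def)

lemma satisfies_relations_shift:
  assumes "satisfies_relations P x" and "\<forall>i. y $ i = ereal c + x $ i"
  shows "satisfies_relations P y"
proof -
  have shift: "p + (ereal c + u) = (p + u) + ereal c" for p u :: ereal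
    by (simp add: ac_simps)
  have le: "a + ereal c \<le> b + ereal c \<longleftrightarrow> a \<le> b" for a b :: ereal
    by (cases a; cases b) auto
  have eq: "a + ereal c = b + ereal c \<longleftrightarrow> a = b" for a b :: ereal
    by (cases a; cases b) auto
  show ?thesis
    using assms unfolding satisfies_relations_def max_attained_twice_alt by (simp add: shift le eq)
qed

text \<open>Membership of a point in a Stiefel line may be tested on any representative.\<close>

lemma class_in_stiefel_line_iff:
  assumes "tropical_vec x"
  shows "trop_equiv `` {x} \<in> stiefel_line A \<longleftrightarrow> satisfies_relations (plucker A) x"
proof
  assume "trop_equiv `` {x} \<in> stiefel_line A"
  then show "satisfies_relations (plucker A) x"
    using equiv_class_self[OF equiv_trop_equiv] assms by (auto simp: stiefel_line_def)
next
  assume "satisfies_relations (plucker A) x"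
  then have "\<forall>y\<in>trop_equiv `` {x}. satisfies_relations (plucker A) y"
    using satisfies_relations_shift unfolding trop_equiv_def by blast
  then show "trop_equiv `` {x} \<in> stiefel_line A"
    using assms by (auto simp: stiefel_line_def trop_points_def intro: quotientI)
qed

end

theory Submission imports Defs begin

text \<open>
  Fix three distinct indices \<open>i, j, k\<close> and write \<open>\<delta> = \<nu> - \<mu>\<close>.  Replacing each \<open>P\<^sub>a\<^sub>b\<close> by
  \<open>Q\<^sub>a\<^sub>b = P\<^sub>a\<^sub>b - \<mu>\<^sub>a - \<mu>\<^sub>b\<close> turns the condition for \<open>\<mu>\<close> into the statement that the maximum of
  \<open>Q\<^sub>j\<^sub>k, Q\<^sub>i\<^sub>k, Q\<^sub>i\<^sub>j\<close> is attained twice, and the condition for \<open>\<nu>\<close> into the same statement about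
  \<open>Q\<^sub>j\<^sub>k + \<delta>\<^sub>i, Q\<^sub>i\<^sub>k + \<delta>\<^sub>j, Q\<^sub>i\<^sub>j + \<delta>\<^sub>k\<close>.  Say \<open>\<delta>\<^sub>i < \<delta>\<^sub>j < \<delta>\<^sub>k\<close>, and suppose that the three
  coordinates are finite.  If \<open>Q\<^sub>i\<^sub>j\<close> were one of two equal maxima in the first condition, then
  \<open>Q\<^sub>i\<^sub>j + \<delta>\<^sub>k\<close> would be the only maximum in the second.  Hence \<open>Q\<^sub>j\<^sub>k = Q\<^sub>i\<^sub>k > Q\<^sub>i\<^sub>j\<close>, and now
  \<open>Q\<^sub>j\<^sub>k + \<delta>\<^sub>i < Q\<^sub>i\<^sub>k + \<delta>\<^sub>j\<close> forces \<open>Q\<^sub>i\<^sub>k + \<delta>\<^sub>j = Q\<^sub>i\<^sub>j + \<delta>\<^sub>k\<close>.  In other words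
  \<open>Q\<^sub>a\<^sub>b = c + max \<delta>\<^sub>a \<delta>\<^sub>b\<close> on the triple, which is \<open>P\<^sub>a\<^sub>b = c + max (\<mu>\<^sub>a + \<nu>\<^sub>b) (\<mu>\<^sub>b + \<nu>\<^sub>a)\<close>.
  The same two conditions show that one finite coordinate makes the other two finite.

  So each triple has its own constant, or is identically \<open>-\<infinity>\<close>.  Two index pairs with a common
  element lie in a common triple, and any two pairs are joined by a chain of such steps; the
  constant, and finiteness, therefore spread to all coordinates from a finite one, which
  every Stiefel matrix has (\<open>plucker_determined\<close>).

  For existence, take the matrix with rows \<open>\<mu>\<close> and \<open>\<nu>\<close>.  The relation for \<open>\<mu>\<close> is the tropical
  expansion of a \<open>3 \<times> 3\<close> determinant with the repeated row \<open>\<mu>\<close>: each monomial occurs in two of the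
  three terms, so the largest one is attained twice (\<open>tdet2_satisfies_relations\<close>).
  Exchanging the rows gives the relation for \<open>\<nu>\<close>.
\<close>

lemma tdet2_commute: "tdet2 a b c e = tdet2 b a e (c :: 'a::{ab_semigroup_add, linorder})"
  by (simp add: tdet2_def max.commute add.commute)

lemma plucker_commute: "plucker A i j = plucker A j i"
  unfolding plucker_def by (rule tdet2_commute)

lemma plucker_not_PInfty:
  assumes "\<forall>r. tropical_vec (A $ r)"
  shows "plucker A i j \<noteq> \<infinity>"
  using assms by (auto simp: plucker_def tdet2_def tropical_vec_def max_def)

text \<open>
  Membership in a Stiefel line compares sums with exactly one off-diagonal coordinate in each, so a
  common real constant cancels and the diagonal is invisible.
\<close>

lemma satisfies_relations_add_const:
  assumes "\<And>i j. i \<noteq> j \<Longrightarrow> Q i j = ereal c + P i j"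
  shows "satisfies_relations Q x \<longleftrightarrow> satisfies_relations P x"
proof -
  have le: "ereal c + a \<le> ereal c + b \<longleftrightarrow> a \<le> b" for a b :: ereal
    by (cases a; cases b) auto
  have eq: "ereal c + a = ereal c + b \<longleftrightarrow> a = b" for a b :: ereal
    by (cases a; cases b) auto
  show ?thesis
    unfolding satisfies_relations_def max_attained_twice_alt by (simp add: assms add.assoc le eq)
qed

lemma stiefel_line_cong:
  assumes "\<And>i j. i \<noteq> j \<Longrightarrow> plucker B i j = ereal c + plucker A i j"
  shows "stiefel_line B = stiefel_line A"
  using satisfies_relations_add_const[of "plucker B" c "plucker A", OF assms]
  by (simp add: stiefel_line_def)

text \<open>
  The case distinction over a triple, in the coordinates in which \<open>\<mu>\<close> is the origin and \<open>\<nu>\<close> is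
  \<open>\<delta>\<close>.  By the first condition either all entries agree or one of them is smaller than the other two,
  which agree; by the second it is smaller, and it is the entry paired with the largest \<open>\<delta>\<close>.  The
  second condition then fixes the difference.
\<close>

lemma triple_determined_at_origin:
  fixes x y z c \<delta>\<^sub>1 \<delta>\<^sub>2 \<delta>\<^sub>3 :: real
  assumes "max_attained_twice x y z"
    and "max_attained_twice (x + \<delta>\<^sub>1) (y + \<delta>\<^sub>2) (z + \<delta>\<^sub>3)"
    and "z = c + max \<delta>\<^sub>1 \<delta>\<^sub>2"
    and "\<delta>\<^sub>1 \<noteq> \<delta>\<^sub>2" "\<delta>\<^sub>1 \<noteq> \<delta>\<^sub>3" "\<delta>\<^sub>2 \<noteq> \<delta>\<^sub>3"
  shows "y = c + max \<delta>\<^sub>1 \<delta>\<^sub>3"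
  using assms unfolding max_attained_twice_alt
  by (elim disjE conjE) (auto simp: max_def split: if_splits)

text \<open>
  The analysis of a single triple, with \<open>p, q, r\<close> in the roles of \<open>P\<^sub>j\<^sub>k, P\<^sub>i\<^sub>k, P\<^sub>i\<^sub>j\<close>: a
  finite coordinate determines its neighbour.  The value \<open>\<infinity>\<close> has to be excluded because it would
  absorb every difference between \<open>m\<close> and \<open>n\<close>.
\<close>

lemma triple_determined:
  fixes p q r :: ereal and m\<^sub>1 m\<^sub>2 m\<^sub>3 n\<^sub>1 n\<^sub>2 n\<^sub>3 :: real
  assumes "q \<noteq> \<infinity>"
    and gen: "m\<^sub>1 - n\<^sub>1 \<noteq> m\<^sub>2 - n\<^sub>2" "m\<^sub>1 - n\<^sub>1 \<noteq> m\<^sub>3 - n\<^sub>3" "m\<^sub>2 - n\<^sub>2 \<noteq> m\<^sub>3 - n\<^sub>3"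
    and m: "max_attained_twice (p + ereal m\<^sub>1) (q + ereal m\<^sub>2) (r + ereal m\<^sub>3)"
    and n: "max_attained_twice (p + ereal n\<^sub>1) (q + ereal n\<^sub>2) (r + ereal n\<^sub>3)"
    and r: "r = ereal (c + tdet2 m\<^sub>1 m\<^sub>2 n\<^sub>1 n\<^sub>2)"
  shows "q = ereal (c + tdet2 m\<^sub>1 m\<^sub>3 n\<^sub>1 n\<^sub>3)"
proof -
  obtain z where z: "r = ereal z" "z = c + tdet2 m\<^sub>1 m\<^sub>2 n\<^sub>1 n\<^sub>2"
    using r by blast
  have p_not_PInfty: "p \<noteq> \<infinity>"
    using m assms(1) by (cases q) (auto simp: z(1) max_attained_twice_alt)
  \<comment> \<open>The finite term \<open>r\<close> cannot be the only one.  If just one other term were finite, these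
    two would be the maxima in both conditions, so \<open>m - n\<close> would agree at two indices.\<close>
  obtain x where x: "p = ereal x"
    using p_not_PInfty m n gen assms(1)
    by (cases p; cases q) (auto simp: z(1) max_attained_twice_alt)
  obtain y where y: "q = ereal y"
    using m n gen assms(1)
    by (cases q) (auto simp: z(1) x max_attained_twice_alt)
  have m': "max_attained_twice (x + m\<^sub>1) (y + m\<^sub>2) (z + m\<^sub>3)"
    using m by (simp add: x y z(1) max_attained_twice_alt)
  have n': "max_attained_twice (x + n\<^sub>1) (y + n\<^sub>2) (z + n\<^sub>3)"
    using n by (simp add: x y z(1) max_attained_twice_alt)
  \<comment> \<open>Translating the columns so that \<open>m\<close> becomes the origin.\<close>
  have "max_attained_twice (x - m\<^sub>2 - m\<^sub>3) (y - m\<^sub>1 - m\<^sub>3) (z - m\<^sub>1 - m\<^sub>2)"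
    using m' by (auto simp: max_attained_twice_alt)
  moreover have "max_attained_twice (x - m\<^sub>2 - m\<^sub>3 + (n\<^sub>1 - m\<^sub>1)) (y - m\<^sub>1 - m\<^sub>3 + (n\<^sub>2 - m\<^sub>2))
      (z - m\<^sub>1 - m\<^sub>2 + (n\<^sub>3 - m\<^sub>3))"
    using n' by (auto simp: max_attained_twice_alt)
  moreover have "z - m\<^sub>1 - m\<^sub>2 = c + max (n\<^sub>1 - m\<^sub>1) (n\<^sub>2 - m\<^sub>2)"
    by (auto simp: z(2) tdet2_def max_def)
  ultimately have "y - m\<^sub>1 - m\<^sub>3 = c + max (n\<^sub>1 - m\<^sub>1) (n\<^sub>3 - m\<^sub>3)"
    by (rule triple_determined_at_origin) (use gen in auto)
  then have "y = c + tdet2 m\<^sub>1 m\<^sub>3 n\<^sub>1 n\<^sub>3"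
    by (auto simp: tdet2_def max_def split: if_splits)
  then show ?thesis
    by (simp add: y)
qed

text \<open>
  The constant is carried from a finite coordinate \<open>P\<^sub>a\<^sub>b\<close> to every pair \<open>{a, j}\<close>, and from there to
  every pair \<open>{i, j}\<close> by way of \<open>{i, a}\<close>.
\<close>

lemma plucker_determined:
  fixes P :: "'d::finite \<Rightarrow> 'd \<Rightarrow> ereal" and \<mu> \<nu> :: "real ^ 'd"
  assumes gen: "\<And>i j. i \<noteq> j \<Longrightarrow> \<mu> $ i - \<nu> $ i \<noteq> \<mu> $ j - \<nu> $ j"
    and sym: "\<And>i j. P i j = P j i"
    and not_PInfty: "\<And>i j. P i j \<noteq> \<infinity>"
    and finite_ab: "a \<noteq> b" "P a b \<noteq> -\<infinity>"
    and \<mu>: "satisfies_relations P (\<chi> i. ereal (\<mu> $ i))"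
    and \<nu>: "satisfies_relations P (\<chi> i. ereal (\<nu> $ i))"
  shows "\<exists>c::real. \<forall>i j. i \<noteq> j \<longrightarrow> P i j = ereal (c + tdet2 (\<mu> $ i) (\<mu> $ j) (\<nu> $ i) (\<nu> $ j))"
proof -
  define t where "t i j = tdet2 (\<mu> $ i) (\<mu> $ j) (\<nu> $ i) (\<nu> $ j)" for i j
  have t_sym: "t i j = t j i" for i j
    unfolding t_def by (rule tdet2_commute)
  obtain c where ab: "P a b = ereal (c + t a b)"
  proof -
    obtain z where "P a b = ereal z"
      using finite_ab(2) not_PInfty[of a b] by (cases "P a b") auto
    then have "P a b = ereal ((z - t a b) + t a b)" by simp
    then show ?thesis by (rule that)
  qed
  have step: "P i k = ereal (c + t i k)"
    if "P i j = ereal (c + t i j)" "i \<noteq> j" "i \<noteq> k" for i j k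
  proof (cases "j = k")
    case False
    then have "distinct [i, j, k]" using that by simp
    then have "max_attained_twice (P j k + ereal (\<mu> $ i)) (P i k + ereal (\<mu> $ j)) (P i j + ereal (\<mu> $ k))"
      and "max_attained_twice (P j k + ereal (\<nu> $ i)) (P i k + ereal (\<nu> $ j)) (P i j + ereal (\<nu> $ k))"
      using \<mu>[unfolded satisfies_relations_def, rule_format, of i j k]
        \<nu>[unfolded satisfies_relations_def, rule_format, of i j k] by simp_all
    then show ?thesis
      using that False unfolding t_def
      by (intro triple_determined[OF not_PInfty gen gen gen]) auto
  qed (use that in simp)
  have star: "P a j = ereal (c + t a j)" if "a \<noteq> j" for j
    using step[OF ab finite_ab(1) that] .
  have "P i j = ereal (c + t i j)" if "i \<noteq> j" for i j
  proof (cases "i = a")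
    case False
    then have "P i a = ereal (c + t i a)"
      using star[of i] sym[of i a] t_sym[of i a] by simp
    then show ?thesis
      using step False that by blast
  qed (use star that in simp)
  then show ?thesis
    unfolding t_def by blast
qed

lemma max_attained_twice_pairwise_max:
  "max_attained_twice (max b c) (max a c) (max a b)"
  by (auto simp: max_attained_twice_alt max_def)

text \<open>
  In \<open>P\<^sub>j\<^sub>k + \<mu>\<^sub>i, P\<^sub>i\<^sub>k + \<mu>\<^sub>j, P\<^sub>i\<^sub>j + \<mu>\<^sub>k\<close> only the three monomials \<open>\<nu>\<^sub>i + \<mu>\<^sub>j + \<mu>\<^sub>k\<close>,
  \<open>\<mu>\<^sub>i + \<nu>\<^sub>j + \<mu>\<^sub>k\<close>, \<open>\<mu>\<^sub>i + \<mu>\<^sub>j + \<nu>\<^sub>k\<close> occur, and each of them in two of the three terms.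
\<close>

lemma tdet2_satisfies_relations:
  fixes \<mu> \<nu> :: "real ^ 'd"
  assumes "\<And>i j. P i j = ereal (tdet2 (\<mu> $ i) (\<mu> $ j) (\<nu> $ i) (\<nu> $ j))"
  shows "satisfies_relations P (\<chi> i. ereal (\<mu> $ i))"
proof -
  have "max_attained_twice (P j k + ereal (\<mu> $ i)) (P i k + ereal (\<mu> $ j)) (P i j + ereal (\<mu> $ k))"
    for i j k
  proof -
    let ?a = "\<nu> $ i + \<mu> $ j + \<mu> $ k" and ?b = "\<mu> $ i + \<nu> $ j + \<mu> $ k"
      and ?c = "\<mu> $ i + \<mu> $ j + \<nu> $ k"
    have "P j k + ereal (\<mu> $ i) = max (ereal ?b) (ereal ?c)"
      "P i k + ereal (\<mu> $ j) = max (ereal ?a) (ereal ?c)"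
      "P i j + ereal (\<mu> $ k) = max (ereal ?a) (ereal ?b)"
      by (simp_all add: assms tdet2_def max_def)
    then show ?thesis
      by (simp only: max_attained_twice_pairwise_max)
  qed
  then show ?thesis
    unfolding satisfies_relations_def by simp
qed

text \<open>Through this symmetry the relations for \<open>\<nu>\<close> are those for \<open>\<mu>\<close>.\<close>

lemma tdet2_swap_rows: "tdet2 a b c e = tdet2 c e a (b :: 'a::{ab_semigroup_add, linorder})"
  by (simp add: tdet2_def max.commute add.commute)

theorem theorem17:
  fixes \<mu> \<nu> :: "real ^ 'd"
  assumes "CARD('d) \<ge> 3"
    and "\<And>i j. i \<noteq> j \<Longrightarrow> \<mu> $ i - \<nu> $ i \<noteq> \<mu> $ j - \<nu> $ j"
  shows "(\<exists>!L. is_stiefel_line L \<and> real_point \<mu> \<in> L \<and> real_point \<nu> \<in> L) \<and>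
    (\<forall>A. stiefel_matrix A \<and> real_point \<mu> \<in> stiefel_line A \<and> real_point \<nu> \<in> stiefel_line A \<longrightarrow>
      (\<exists>c::real. \<forall>i j. i \<noteq> j \<longrightarrow>
        plucker A i j = ereal (c + tdet2 (\<mu> $ i) (\<mu> $ j) (\<nu> $ i) (\<nu> $ j))))"
proof -
  let ?t = "\<lambda>i j. tdet2 (\<mu> $ i) (\<mu> $ j) (\<nu> $ i) (\<nu> $ j)"
  have mem: "real_point \<rho> \<in> stiefel_line A \<longleftrightarrow>
      satisfies_relations (plucker A) (\<chi> i. ereal (\<rho> $ i))" for \<rho> :: "real ^ 'd" and A
    unfolding real_point_def
    by (rule class_in_stiefel_line_iff) (simp add: tropical_vec_def)
  have determined: "\<exists>c::real. \<forall>i j. i \<noteq> j \<longrightarrow> plucker A i j = ereal (c + ?t i j)"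
    if "stiefel_matrix A" "real_point \<mu> \<in> stiefel_line A" "real_point \<nu> \<in> stiefel_line A" for A
  proof -
    obtain a b where ab: "a \<noteq> b" "plucker A a b \<noteq> -\<infinity>"
      using \<open>stiefel_matrix A\<close> unfolding stiefel_matrix_def by blast
    have "\<forall>r. tropical_vec (A $ r)"
      using \<open>stiefel_matrix A\<close> unfolding stiefel_matrix_def by blast
    then show ?thesis
      using that(2,3) unfolding mem
      by (intro plucker_determined[OF assms(2) plucker_commute plucker_not_PInfty ab]) auto
  qed
  define M :: "ereal ^ 'd ^ 2" where
    "M = (\<chi> r. if r = 1 then (\<chi> i. ereal (\<mu> $ i)) else (\<chi> i. ereal (\<nu> $ i)))"
  have M: "plucker M i j = ereal (?t i j)" for i j
    by (simp add: plucker_def M_def tdet2_def)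
  obtain a b :: 'd where "a \<noteq> b"
  proof -
    have "\<not> card (UNIV :: 'd set) \<le> Suc 0"
      using assms(1) by simp
    moreover have "finite (UNIV :: 'd set)"
      by simp
    ultimately show ?thesis
      using that by (metis card_le_Suc0_iff_eq)
  qed
  then have M_stiefel: "stiefel_matrix M"
    unfolding stiefel_matrix_def M by (auto simp: M_def tropical_vec_def)
  have M_mem: "real_point \<mu> \<in> stiefel_line M" "real_point \<nu> \<in> stiefel_line M"
    unfolding mem
    by (rule tdet2_satisfies_relations[OF M])
      (rule tdet2_satisfies_relations, simp add: M, rule tdet2_swap_rows)
  have unique: "stiefel_line A = stiefel_line M"
    if A: "stiefel_matrix A" "real_point \<mu> \<in> stiefel_line A" "real_point \<nu> \<in> stiefel_line A" for A
  proof -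
    obtain c where "\<And>i j. i \<noteq> j \<Longrightarrow> plucker A i j = ereal (c + ?t i j)"
      using determined[OF A] by blast
    then show ?thesis
      by (intro stiefel_line_cong[where c = c]) (simp add: M)
  qed
  have "\<exists>!L. is_stiefel_line L \<and> real_point \<mu> \<in> L \<and> real_point \<nu> \<in> L"
    using M_stiefel M_mem unique unfolding is_stiefel_line_def
    by (intro ex1I[of _ "stiefel_line M"]) blast+
  then show ?thesis
    using determined by blast
qed

end
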